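(* There exists a weighted backward shift $B_w$ (with a bounded weight sequence $w=(w_n)_{n\ge1}$ of non-zero scalars) on $c_0$ that is very frequently hypercyclic but not chaotic. In particular, it does not have any unimodular eigenvalues (eigenvalues $\lambda$ with $|\lambda|=1$), it is not mixing, and it does not admit any non-trivial invariant Gaussian measure.
   Context: $c_0=c_0(\mathbb{N}_0)$ is the Banach space of (real or complex) null sequences $(x_n)_{n\ge0}$ with the sup norm, where $\mathbb{N}_0=\{0,1,2,\ldots\}$. For a sequence $w=(w_n)_{n\ge1}$ of non-zero scalars, the weighted backward shift is $B_w((x_n)_{n\geq 0})=(w_{n+1}x_{n+1})_{n\geq 0}$; it is an operator (continuous linear self-map) on $c_0$ exactly when $w$ is bounded. For $A\subset\mathbb{N}_0$, $\underline{\mathrm{dens}}\, A = \liminf_{N\to\infty} \frac{1}{N+1}\mathrm{card} (A \cap [0,N])$ and $A-n=\{k-n : k\in A, k\geq n\}$. Let $\mathcal{A}_{\mathrm{Hin}}$ be the family of sets $A\subset\mathbb{N}_0$ for which $\lim_{N\to\infty} \underline{\mathrm{dens}}\, \bigcup_{n=0}^N (A-n) = 1$. A continuous map $T:X\to X$ is very frequently hypercyclic if there exists $x\in X$ such that, for any non-empty open set $U$ in $X$, $\{n\ge0: T^nx\in U\}\in\mathcal{A}_{\mathrm{Hin}}$. $T$ is hypercyclic if some point has a dense orbit $\{T^nx:n\ge0\}$, and chaotic if it is hypercyclic and admits a dense set of periodic points. $T$ is mixing if for any non-empty open sets $U,V$ there is $N$ such that $T^n(U)\cap V\neq\varnothing$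 for all $n\geq N$. A Gaussian measure is non-trivial if it is different from the Dirac measure at $0$. *)

theory Defs
  imports "HOL-Probability.Probability"
begin

section \<open>The Banach space of null sequences\<close>

typedef (overloaded) 'a c0 = "{x :: nat \<Rightarrow> 'a::real_normed_vector. x \<longlonglongrightarrow> 0}"
  morphisms c0_nth Abs_c0
  by (auto intro!: exI[of _ "\<lambda>_. 0"])

setup_lifting type_definition_c0

lemma c0_tendsto: "c0_nth x \<longlonglongrightarrow> 0"
  using c0_nth by auto

lemma c0_eqI: "(\<And>n. c0_nth x n = c0_nth y n) \<Longrightarrow> x = y"
  by (auto simp flip: c0_nth_inject)

lemma c0_bdd_above: "bdd_above (range (\<lambda>n. norm (c0_nth x n)))"
proof -
  have "bounded (range (c0_nth x))"
    using c0_tendsto convergent_imp_bounded by blast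
  then show ?thesis
    by (auto simp: bounded_iff bdd_above_def)
qed

instantiation c0 :: (real_normed_vector) real_normed_vector
begin

lift_definition zero_c0 :: "'a c0" is "\<lambda>_. 0"
  by simp

lift_definition plus_c0 :: "'a c0 \<Rightarrow> 'a c0 \<Rightarrow> 'a c0" is "\<lambda>x y n. x n + y n"
  using tendsto_add by fastforce

lift_definition uminus_c0 :: "'a c0 \<Rightarrow> 'a c0" is "\<lambda>x n. - x n"
  using tendsto_minus by fastforce

lift_definition minus_c0 :: "'a c0 \<Rightarrow> 'a c0 \<Rightarrow> 'a c0" is "\<lambda>x y n. x n - y n"
  using tendsto_diff by fastforce

lift_definition scaleR_c0 :: "real \<Rightarrow> 'a c0 \<Rightarrow> 'a c0" is "\<lambda>c x n. c *\<^sub>R x n"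
  by (rule tendsto_scaleR[OF tendsto_const, where b = 0, simplified])

definition norm_c0 :: "'a c0 \<Rightarrow> real" where
  "norm_c0 x = (SUP n. norm (c0_nth x n))"

definition dist_c0 :: "'a c0 \<Rightarrow> 'a c0 \<Rightarrow> real" where
  "dist_c0 x y = norm (x - y)"

definition sgn_c0 :: "'a c0 \<Rightarrow> 'a c0" where
  "sgn_c0 x = inverse (norm x) *\<^sub>R x"

definition uniformity_c0 :: "('a c0 \<times> 'a c0) filter" where
  "uniformity_c0 = (INF e\<in>{0<..}. principal {(x, y). dist x y < e})"

definition open_c0 :: "'a c0 set \<Rightarrow> bool" where
  "open_c0 S = (\<forall>x\<in>S. \<forall>\<^sub>F (x', y) in uniformity. x' = x \<longrightarrow> y \<in> S)"

lemma norm_nth_le_c0: "norm (c0_nth x n) \<le> norm x"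
  unfolding norm_c0_def by (rule cSUP_upper[OF _ c0_bdd_above]) simp

lemma norm_c0_le: "(\<And>n. norm (c0_nth x n) \<le> b) \<Longrightarrow> norm x \<le> b"
  unfolding norm_c0_def by (rule cSUP_least) auto

instance
proof
  fix x y z :: "'a c0" and a b :: real
  show "x + y + z = x + (y + z)" "x + y = y + x" "0 + x = x" "- x + x = 0" "x - y = x + - y"
    "a *\<^sub>R (x + y) = a *\<^sub>R x + a *\<^sub>R y" "(a + b) *\<^sub>R x = a *\<^sub>R x + b *\<^sub>R x"
    "a *\<^sub>R b *\<^sub>R x = (a * b) *\<^sub>R x" "1 *\<^sub>R x = x"
    by (transfer; simp add: algebra_simps)+
  show "norm x = 0 \<longleftrightarrow> x = 0"
  proof
    assume "norm x = 0"
    then have "c0_nth x n = 0" for n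
      using norm_nth_le_c0[of x n] by simp
    then show "x = 0"
      by (intro c0_eqI) (simp add: zero_c0.rep_eq)
  qed (simp add: norm_c0_def zero_c0.rep_eq)
  show "norm (x + y) \<le> norm x + norm y"
    by (rule norm_c0_le)
      (auto simp: plus_c0.rep_eq intro!: norm_triangle_le add_mono norm_nth_le_c0)
  show "norm (a *\<^sub>R x) = \<bar>a\<bar> * norm x"
  proof (rule antisym)
    have le: "norm (a *\<^sub>R x) \<le> \<bar>a\<bar> * norm x" for a and x :: "'a c0"
      by (rule norm_c0_le) (auto simp: scaleR_c0.rep_eq intro!: mult_left_mono norm_nth_le_c0)
    show "norm (a *\<^sub>R x) \<le> \<bar>a\<bar> * norm x"
      by (rule le)
    show "\<bar>a\<bar> * norm x \<le> norm (a *\<^sub>R x)"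
    proof (cases "a = 0")
      case True
      then show ?thesis
        using norm_nth_le_c0[of "a *\<^sub>R x" 0] order_trans[OF norm_ge_zero] by auto
    next
      case False
      have "inverse a *\<^sub>R (a *\<^sub>R x) = x"
        using False by (intro c0_eqI) (simp add: scaleR_c0.rep_eq)
      then have "norm x \<le> \<bar>inverse a\<bar> * norm (a *\<^sub>R x)"
        using le[of "inverse a" "a *\<^sub>R x"] by simp
      then show ?thesis
        using False by (simp add: field_simps)
    qed
  qed
qed (rule dist_c0_def sgn_c0_def uniformity_c0_def open_c0_def)+

end

instance c0 :: (banach) banach
proof
  fix X :: "nat \<Rightarrow> 'a c0"
  assume X: "Cauchy X"
  have nth: "norm (c0_nth (X m) n - c0_nth (X k) n) \<le> norm (X m - X k)" for m k n
    using norm_nth_le_c0[of "X m - X k" n] by (simp add: minus_c0.rep_eq)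
  have "Cauchy (\<lambda>m. c0_nth (X m) n)" for n
  proof (rule CauchyI)
    fix e :: real assume "e > 0"
    then obtain M where "\<forall>m\<ge>M. \<forall>k\<ge>M. norm (X m - X k) < e"
      using CauchyD[OF X] by blast
    then show "\<exists>M. \<forall>m\<ge>M. \<forall>k\<ge>M. norm (c0_nth (X m) n - c0_nth (X k) n) < e"
      using le_less_trans[OF nth] by blast
  qed
  then have "\<exists>L. (\<lambda>m. c0_nth (X m) n) \<longlonglongrightarrow> L" for n
    unfolding convergent_def[symmetric] by (rule Cauchy_convergent)
  then obtain l where l: "\<And>n. (\<lambda>m. c0_nth (X m) n) \<longlonglongrightarrow> l n"
    by metis
  have unif: "\<exists>M. \<forall>m\<ge>M. \<forall>n. norm (c0_nth (X m) n - l n) \<le> e" if "e > 0" for e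
  proof -
    obtain M where M: "\<And>m k. m \<ge> M \<Longrightarrow> k \<ge> M \<Longrightarrow> norm (X m - X k) < e"
      using CauchyD[OF X \<open>e > 0\<close>] by blast
    have "norm (c0_nth (X m) n - l n) \<le> e" if "m \<ge> M" for m n
    proof (rule tendsto_upperbound)
      show "(\<lambda>k. norm (c0_nth (X m) n - c0_nth (X k) n)) \<longlonglongrightarrow> norm (c0_nth (X m) n - l n)"
        by (intro tendsto_intros l)
      show "\<forall>\<^sub>F k in sequentially. norm (c0_nth (X m) n - c0_nth (X k) n) \<le> e"
        using order_trans[OF nth less_imp_le[OF M[OF that]]] by (rule eventually_sequentiallyI)
    qed simp
    then show ?thesis by blast
  qed
  have "l \<longlonglongrightarrow> 0"
  proof (rule LIMSEQ_I)
    fix r :: real assume "r > 0"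
    then obtain m where m: "\<And>n. norm (c0_nth (X m) n - l n) \<le> r / 2"
      using unif[of "r / 2"] by auto
    obtain N where "\<And>n. n \<ge> N \<Longrightarrow> norm (c0_nth (X m) n) < r / 2"
      using LIMSEQ_D[OF c0_tendsto[of "X m"], of "r / 2"] \<open>r > 0\<close> by auto
    then have "norm (l n) < r" if "n \<ge> N" for n
      using m[of n] that norm_triangle_sub[of "l n" "c0_nth (X m) n"]
        norm_minus_commute[of "l n" "c0_nth (X m) n"] by fastforce
    then show "\<exists>N. \<forall>n\<ge>N. norm (l n - 0) < r" by auto
  qed
  then have l_nth: "c0_nth (Abs_c0 l) = l"
    by (simp add: Abs_c0_inverse)
  have "X \<longlonglongrightarrow> Abs_c0 l"
  proof (rule LIMSEQ_I)
    fix r :: real assume "r > 0"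
    then obtain M where "\<And>m n. m \<ge> M \<Longrightarrow> norm (c0_nth (X m) n - l n) \<le> r / 2"
      using unif[of "r / 2"] by auto
    then have "norm (X m - Abs_c0 l) \<le> r / 2" if "m \<ge> M" for m
      using that by (intro norm_c0_le) (simp add: minus_c0.rep_eq l_nth)
    then show "\<exists>M. \<forall>m\<ge>M. norm (X m - Abs_c0 l) < r"
      using \<open>r > 0\<close> by (intro exI[of _ M]) fastforce
  qed
  then show "convergent X" by (auto simp: convergent_def)
qed

text \<open>Multiplication by scalars of the ground field; \<^const>\<open>scaleR\<close> only covers real scalars.\<close>

lift_definition scaleK :: "'k::real_normed_field \<Rightarrow> 'k c0 \<Rightarrow> 'k c0" (infixr \<open>*\<^sub>K\<close> 75)
  is "\<lambda>c x n. c * x n"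
  by (rule tendsto_mult_right_zero)

lemma vector_space_scaleK: "vector_space (scaleK :: 'k::real_normed_field \<Rightarrow> _)"
  by unfold_locales (transfer; simp add: algebra_simps)+

lemma norm_scaleK: "norm (c *\<^sub>K x) = norm c * norm x"
proof (rule antisym)
  have le: "norm (c *\<^sub>K x) \<le> norm c * norm x" for c :: 'a and x
    by (rule norm_c0_le) (auto simp: scaleK.rep_eq norm_mult intro!: mult_left_mono norm_nth_le_c0)
  show "norm (c *\<^sub>K x) \<le> norm c * norm x"
    by (rule le)
  show "norm c * norm x \<le> norm (c *\<^sub>K x)"
  proof (cases "c = 0")
    case False
    have "inverse c *\<^sub>K (c *\<^sub>K x) = x"
      using False by (intro c0_eqI) (simp add: scaleK.rep_eq)
    then have "norm x \<le> inverse (norm c) * norm (c *\<^sub>K x)"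
      using le[of "inverse c" "c *\<^sub>K x"] by (simp only: norm_inverse)
    then show ?thesis
      using False by (simp add: field_simps)
  qed simp
qed


section \<open>Weighted backward shifts\<close>

text \<open>The value \<open>w 0\<close> is never used. If \<open>w\<close> is unbounded, the shifted sequence need not
  be a null sequence, and then the value of \<open>Abs_c0\<close> carries no meaning.\<close>

definition weighted_shift :: "(nat \<Rightarrow> 'k::real_normed_field) \<Rightarrow> 'k c0 \<Rightarrow> 'k c0" where
  "weighted_shift w x = Abs_c0 (\<lambda>n. w (Suc n) * c0_nth x (Suc n))"

lemma weighted_shift_nth:
  assumes "bounded (w ` {1..})"
  shows "c0_nth (weighted_shift w x) n = w (Suc n) * c0_nth x (Suc n)"
proof -
  obtain B where B: "\<And>n. n \<ge> 1 \<Longrightarrow> norm (w n) \<le> B"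
    using assms by (auto simp: bounded_iff)
  have "(\<lambda>n. w (Suc n) * c0_nth x (Suc n)) \<longlonglongrightarrow> 0"
  proof (rule Lim_null_comparison)
    show "\<forall>\<^sub>F n in sequentially. norm (w (Suc n) * c0_nth x (Suc n)) \<le> B * norm (c0_nth x (Suc n))"
      using B by (auto simp: norm_mult intro!: mult_right_mono always_eventually)
    have "(\<lambda>n. c0_nth x (Suc n)) \<longlonglongrightarrow> 0"
      using LIMSEQ_Suc[OF c0_tendsto] .
    then show "(\<lambda>n. B * norm (c0_nth x (Suc n))) \<longlonglongrightarrow> 0"
      by (intro tendsto_mult_right_zero tendsto_norm_zero)
  qed
  then show ?thesis
    by (simp add: weighted_shift_def Abs_c0_inverse)
qed

lemma weighted_shift_operator:
  assumes "bounded (w ` {1..})"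
  shows "Vector_Spaces.linear scaleK scaleK (weighted_shift w)"
    and "continuous_on UNIV (weighted_shift w)"
proof -
  note nth = weighted_shift_nth[OF assms]
  show "Vector_Spaces.linear scaleK scaleK (weighted_shift w)"
    by (simp add: Vector_Spaces.linear_iff vector_space_scaleK)
      (auto intro!: c0_eqI simp: nth plus_c0.rep_eq scaleK.rep_eq algebra_simps)
  obtain B where B: "\<And>n. n \<ge> 1 \<Longrightarrow> norm (w n) \<le> B"
    using assms by (auto simp: bounded_iff)
  have "bounded_linear (weighted_shift w)"
  proof (rule bounded_linear_intro)
    show "norm (weighted_shift w x) \<le> norm x * B" for x
      using B B[THEN order_trans[OF norm_ge_zero]]
      by (intro norm_c0_le) (auto simp: nth norm_mult mult.commute[of "norm x"] intro!: mult_mono norm_nth_le_c0)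
  qed (auto intro!: c0_eqI simp: nth plus_c0.rep_eq scaleR_c0.rep_eq algebra_simps)
  then show "continuous_on UNIV (weighted_shift w)"
    by (rule linear_continuous_on)
qed

definition eigenvalue :: "('k::real_normed_field c0 \<Rightarrow> 'k c0) \<Rightarrow> 'k \<Rightarrow> bool" where
  "eigenvalue T c \<longleftrightarrow> (\<exists>x. x \<noteq> 0 \<and> T x = c *\<^sub>K x)"


section \<open>Topological dynamics\<close>

definition lower_density :: "nat set \<Rightarrow> ereal" where
  "lower_density A = liminf (\<lambda>N. ereal (real (card (A \<inter> {0..N})) / real (N + 1)))"

definition shift_set :: "nat set \<Rightarrow> nat \<Rightarrow> nat set" where
  "shift_set A n = {k - n | k. k \<in> A \<and> k \<ge> n}"

definition Hin :: "nat set set" where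
  "Hin = {A. (\<lambda>N. lower_density (\<Union>n\<in>{0..N}. shift_set A n)) \<longlonglongrightarrow> 1}"

definition very_frequently_hypercyclic :: "('a::topological_space \<Rightarrow> 'a) \<Rightarrow> bool" where
  "very_frequently_hypercyclic T \<longleftrightarrow>
    (\<exists>x. \<forall>U. open U \<and> U \<noteq> {} \<longrightarrow> {n. (T ^^ n) x \<in> U} \<in> Hin)"

definition hypercyclic :: "('a::topological_space \<Rightarrow> 'a) \<Rightarrow> bool" where
  "hypercyclic T \<longleftrightarrow> (\<exists>x. closure (range (\<lambda>n. (T ^^ n) x)) = UNIV)"

definition periodic_points :: "('a \<Rightarrow> 'a) \<Rightarrow> 'a set" where
  "periodic_points T = {x. \<exists>n\<ge>1. (T ^^ n) x = x}"

definition chaotic :: "('a::topological_space \<Rightarrow> 'a) \<Rightarrow> bool" where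
  "chaotic T \<longleftrightarrow> hypercyclic T \<and> closure (periodic_points T) = UNIV"

definition mixing :: "('a::topological_space \<Rightarrow> 'a) \<Rightarrow> bool" where
  "mixing T \<longleftrightarrow>
    (\<forall>U V. open U \<and> U \<noteq> {} \<and> open V \<and> V \<noteq> {} \<longrightarrow>
      (\<exists>N. \<forall>n\<ge>N. (T ^^ n) ` U \<inter> V \<noteq> {}))"


section \<open>Gaussian measures\<close>

text \<open>
  Centred Gaussian density of parameter \<open>\<sigma>\<close> on the scalar field with respect to Lebesgue measure.
  For real scalars it is the usual normal density, for complex scalars it is
  \<open>exp (- \<bar>z\<bar>\<^sup>2 / (2 \<sigma>\<^sup>2)) / (2 \<pi> \<sigma>\<^sup>2)\<close>, the density of a symmetric complex Gaussian variable.
\<close>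

definition gaussian_density :: "real \<Rightarrow> 'k::euclidean_space \<Rightarrow> real" where
  "gaussian_density \<sigma> z =
    1 / sqrt (2 * pi * \<sigma>\<^sup>2) ^ DIM('k) * exp (- (norm z)\<^sup>2 / (2 * \<sigma>\<^sup>2))"

lemma gaussian_density_real: "gaussian_density \<sigma> (x::real) = normal_density 0 \<sigma> x"
  by (simp add: gaussian_density_def normal_density_def)

lemma gaussian_density_complex:
  "gaussian_density \<sigma> (z::complex) = normal_density 0 \<sigma> (Re z) * normal_density 0 \<sigma> (Im z)"
proof -
  have "exp (- (norm z)\<^sup>2 / (2 * \<sigma>\<^sup>2)) =
      exp (- (Re z)\<^sup>2 / (2 * \<sigma>\<^sup>2)) * exp (- (Im z)\<^sup>2 / (2 * \<sigma>\<^sup>2))"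
    by (simp add: cmod_power2 diff_divide_distrib flip: exp_add)
  then show ?thesis
    by (simp add: gaussian_density_def normal_density_def power2_eq_square)
qed

text \<open>The Dirac measure at \<open>0\<close> is the degenerate case of variance \<open>0\<close>.\<close>

definition gaussian_variable :: "'a measure \<Rightarrow> ('a \<Rightarrow> 'k::euclidean_space) \<Rightarrow> bool" where
  "gaussian_variable M f \<longleftrightarrow>
    f \<in> borel_measurable M \<and>
    (distr M borel f = return borel 0 \<or>
     (\<exists>\<sigma>>0. distributed M lborel f (\<lambda>z. ennreal (gaussian_density \<sigma> z))))"

definition gaussian_measure ::
    "'k::{real_normed_field, euclidean_space} c0 measure \<Rightarrow> bool" where
  "gaussian_measure M \<longleftrightarrow>
    prob_space M \<and> sets M = sets borel \<and>
    (\<forall>f :: 'k c0 \<Rightarrow> 'k. Vector_Spaces.linear scaleK (*) f \<and> continuous_on UNIV f \<longrightarrow>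
       gaussian_variable M f)"

definition invariant_measure :: "('a::topological_space \<Rightarrow> 'a) \<Rightarrow> 'a measure \<Rightarrow> bool" where
  "invariant_measure T M \<longleftrightarrow> distr M borel T = M"

end

theory Submission
  imports Defs
begin

text \<open>
  Write \<open>v n = w 1 * \<dots> * w n\<close>. Passing from \<open>x\<close> to \<open>y n = v n * x n\<close> turns the weighted shift into
  the plain backward shift on the sequences with \<open>y n / v n \<longrightarrow> 0\<close>. The weight is chosen so that \<open>v\<close> is
  \<open>1\<close> at a sparse sequence of dips \<open>d 0 < d 1 < \<dots>\<close> and doubles at every step between two dips.

  All the negative assertions come from \<open>v (d k) = 1\<close>, which says that coordinate \<open>0\<close> of
  \<open>T ^^ d k\<close> applied to \<open>x\<close> is \<open>x (d k)\<close> and therefore tends to \<open>0\<close>, for every \<open>x\<close>. Hence the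
  first coordinate can neither keep its modulus (no unimodular eigenvalue), nor return to its value
  along multiples of a period (no periodic orbit starting near the first unit vector),
  nor become large at every late time on the unit ball (no mixing). Under an
  invariant probability measure the random variables \<open>x (d k)\<close> all have the law of \<open>x 0\<close>, so that
  \<open>x 0 = 0\<close> almost surely, and the same holds for the other coordinates by invariance: the Dirac measure
  at \<open>0\<close> is the only invariant probability measure.

  For very frequent hypercyclicity, a sequence \<open>y\<close> is assembled from blocks: block number \<open>p\<close> is copied
  to the positions \<open>m, \<dots>, m + p - 1\<close> for every \<open>m\<close> in a set \<open>visits p\<close>. Seen from a time
  \<open>n \<in> visits p\<close>, all other blocks must lie where \<open>v\<close> is large, that is, they must stay away from the
  translates \<open>n + d k\<close> of the dips and from a short interval of recovery after each of them.
  The dips are \<open>d k = q 0 + \<dots> + q (k - 1)\<close> for rapidly growing \<open>q\<close> with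
  \<open>q k dvd q (k + 1)\<close>. Modulo \<open>q K\<close> every dip is then one of \<open>d 0, \<dots>, d K\<close>, all of which are small
  compared with \<open>q K\<close>. Thus it suffices that \<open>visits K\<close> consists of multiples of \<open>q K\<close> and that
  \<open>visits p\<close>, for \<open>p < K\<close>, avoids a neighbourhood of the multiples of \<open>q K\<close>
  (lemmas \<open>visits_gap\<close> and \<open>visits_escape\<close>). These neighbourhoods have a density that is summable in
  \<open>K\<close>, with a sum that stays small even when they are enlarged by a bounded multiple of the previous
  period. Outside the enlarged neighbourhoods for large \<open>K\<close>, the set \<open>visits p\<close> has bounded gaps,
  which is what membership in the family \<open>Hin\<close> asks for (lemma \<open>visits_Hin\<close>).
\<close>

section \<open>Two scales of integers\<close>

primrec period :: "nat \<Rightarrow> nat" where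
  "period 0 = 1"
| "period (Suc k) = 2 ^ (k + 8) * period k"

declare period.simps(2) [simp del]

definition dip :: "nat \<Rightarrow> nat" where
  "dip k = (\<Sum>i<k. period i)"

lemma period_pos [simp]: "0 < period k"
  by (induction k) (auto simp: period.simps)

lemma period_Suc_ge: "256 * period k \<le> period (Suc k)"
proof -
  have "(2::nat) ^ 8 \<le> 2 ^ (k + 8)"
    by (rule power_increasing) auto
  then show ?thesis
    by (simp add: period.simps del: power_add)
qed

lemma period_dvd: "k \<le> j \<Longrightarrow> period k dvd period j"
  by (induction j rule: dec_induct) (auto simp: period.simps)

lemma period_mono: "k \<le> j \<Longrightarrow> period k \<le> period j"
  by (simp add: dvd_imp_le period_dvd)

lemma dip_0 [simp]: "dip 0 = 0"
  by (simp add: dip_def)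

lemma dip_Suc: "dip (Suc k) = dip k + period k"
  by (simp add: dip_def)

lemma dip_strict_mono: "strict_mono dip"
  by (simp add: strict_mono_Suc_iff dip_Suc)

lemma dip_ge: "k \<le> dip k"
  using dip_strict_mono by (rule strict_mono_imp_increasing)

text \<open>
  The margin on which all separation estimates rest: the dips up to number \<open>K = Suc k\<close>, a recovery
  time \<open>2 * K\<close> after each of them and a block length \<open>K\<close> together fit into the radius
  \<open>4 * period k\<close>, which is tiny compared with \<open>period K\<close>.
\<close>

lemma dip_Suc_le: "dip (Suc k) + 3 * Suc k \<le> 4 * period k"
proof (induction k)
  case 0
  then show ?case by (simp add: dip_def)
next
  case (Suc k)
  then show ?case
    using period_Suc_ge[of k] period_pos[of k] unfolding dip_Suc[of "Suc k"] by simp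
qed

lemma dip_less_period: "dip k + 3 * k < period k"
proof (cases k)
  case (Suc j)
  then show ?thesis
    using dip_Suc_le[of j] period_Suc_ge[of j] period_pos[of j] by simp
qed simp

text \<open>
  Every period added after stage \<open>K\<close> is a multiple of \<open>period K\<close>, so the later dips are
  indistinguishable from \<open>dip K\<close> modulo \<open>period K\<close>.
\<close>

lemma dip_cong:
  assumes "K \<le> k"
  shows "\<exists>z. dip k = dip K + period K * z \<and> (K < k \<longrightarrow> 1 \<le> z)"
  using assms
proof (induction k rule: dec_induct)
  case base
  then show ?case by (intro exI[of _ 0]) auto
next
  case (step n)
  then obtain z where z: "dip n = dip K + period K * z" by blast
  obtain a where a: "period n = period K * a"
    using period_dvd[OF step.hyps(1)] by (auto elim: dvdE)
  have "a \<ge> 1"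
    using a period_pos[of n] by (cases a) auto
  then show ?case
    using z a by (intro exI[of _ "z + a"]) (simp add: dip_Suc algebra_simps)
qed

text \<open>
  Dips are either small on the scale of \<open>period K\<close> or congruent to \<open>dip K\<close>. The last alternative
  prevents the remainder from being confused with an offset inside a block, since \<open>K \<le> dip K\<close>.
\<close>

lemma dip_decomposition:
  obtains z e where "dip k + t = period K * z + e" "e \<le> dip K + t" "z = 0 \<or> dip K \<le> e"
proof (cases "k \<le> K")
  case True
  then have "dip k \<le> dip K"
    using dip_strict_mono by (simp add: strict_mono_less_eq)
  then show ?thesis
    using that[of 0 "dip k + t"] by simp
next
  case False
  then obtain z where "dip k = dip K + period K * z"
    using dip_cong[of K k] by auto
  then show ?thesis
    using that[of z "dip K + t"] by simp
qed


section \<open>The visiting times\<close>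

text \<open>
  The times at which block \<open>p\<close> is placed. Only positive multiples of the longer periods are
  avoided (\<open>1 \<le> s\<close>): no block of index \<open>k\<close> sits near \<open>0\<close>, and avoiding \<open>s = 0\<close> for all \<open>k\<close> would leave
  the set empty.
\<close>

definition visits :: "nat \<Rightarrow> nat set" where
  "visits p = {n. 0 < n \<and> period p dvd n \<and>
     (\<forall>k\<ge>p. \<forall>s::int. 1 \<le> s \<longrightarrow> 4 * int (period k) < \<bar>int n - int (period (Suc k)) * s\<bar>)}"

lemma visits_far:
  assumes "n \<in> visits p" "p < K" "1 \<le> s"
  shows "int (dip K + 3 * K) < \<bar>int n - int (period K) * s\<bar>"
proof -
  obtain j where j: "K = Suc j" "p \<le> j"
    using assms(2) by (cases K) auto
  have "4 * int (period j) < \<bar>int n - int (period (Suc j)) * s\<bar>"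
    using assms j by (auto simp: visits_def)
  then show ?thesis
    using dip_Suc_le[of j] unfolding j by linarith
qed

lemma visits_multiple:
  assumes "n \<in> visits p"
  obtains s where "n = period p * s" "1 \<le> s"
proof -
  have "period p dvd n" "0 < n"
    using assms by (auto simp: visits_def)
  then obtain s where "n = period p * s" "0 < n"
    unfolding dvd_def by blast
  moreover from this have "1 \<le> s"
    by (cases s) auto
  ultimately show thesis
    using that by blast
qed

lemma visits_ge: "n \<in> visits p \<Longrightarrow> period p \<le> n"
  by (erule visits_multiple) simp

lemma mult_add_unique:
  fixes a b q :: nat
  assumes "q * a + e = q * b + l" "e < q" "l < q"
  shows "a = b \<and> e = l"
proof -
  have "a = (q * a + e) div q" "b = (q * b + l) div q"
    using assms(2,3) by auto
  then have "a = b"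
    using assms(1) by simp
  then show ?thesis
    using assms(1) by simp
qed

text \<open>
  Seen from a visiting time \<open>n\<close>, a copy of another block meets no position \<open>dip k + t\<close> with \<open>t\<close> below
  twice the larger block index \<open>K\<close>. Otherwise \<open>m\<close> and \<open>n\<close> would differ, up to \<open>dip K + 3 * K\<close>, by a multiple of
  \<open>period K\<close>. If the indices differ, this contradicts the fact that one of the two times is a multiple of
  \<open>period K\<close> while the other is far from all of these. If they agree, both times are multiples of \<open>period K\<close>,
  so the remainder of \<open>dip k + t\<close> would have to be an offset inside the block, which is too short for that.
\<close>

lemma visits_gap:
  assumes n: "n \<in> visits p" and m: "m \<in> visits p'" and l: "l < p'"
    and eq: "n + (dip k + t) = m + l" and ne: "(p', m) \<noteq> (p, n)"
  shows "2 * max p p' \<le> t"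
proof (rule ccontr)
  define K where "K = max p p'"
  assume "\<not> ?thesis"
  then have t: "t < 2 * K" by (simp add: K_def)
  obtain z e where ze: "dip k + t = period K * z + e" "e \<le> dip K + t" "z = 0 \<or> dip K \<le> e"
    by (rule dip_decomposition)
  have eK: "e < dip K + 2 * K" and lK: "l < K" and dK: "K \<le> dip K"
    using ze(2) t l dip_ge[of K] by (auto simp: K_def)
  consider "p < p'" "K = p'" | "p' < p" "K = p" | "p = p'" "K = p"
    by (auto simp: K_def max_def) linarith
  then show False
  proof cases
    case 1
    obtain s where s: "m = period K * s" "1 \<le> s"
      using visits_multiple[OF m] 1 by blast
    have eqn: "n + (period K * z + e) = period K * s + l"
      using eq ze s by simp
    show False
    proof (cases "z < s")
      case True
      have "int n - int (period K) * int (s - z) = int l - int e"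
        using arg_cong[OF eqn, of int] True by (simp add: of_nat_diff algebra_simps)
      moreover have "int (dip K + 3 * K) < \<bar>int n - int (period K) * int (s - z)\<bar>"
        using visits_far[OF n] 1 True by simp
      ultimately show False
        using eK lK by linarith
    next
      case False
      then have "period K * s \<le> period K * z" by simp
      then have "n + e \<le> l" using eqn by linarith
      moreover have "z \<noteq> 0" using False s by simp
      ultimately show False
        using ze(3) lK dK by linarith
    qed
  next
    case 2
    obtain s where s: "n = period K * s" "1 \<le> s"
      using visits_multiple[OF n] 2 by blast
    have eqn: "period K * (s + z) + e = m + l"
      using eq ze s by (simp add: algebra_simps)
    have "int m - int (period K) * int (s + z) = int e - int l"
      using arg_cong[OF eqn, of int] by (simp add: algebra_simps)
    moreover have "int (dip K + 3 * K) < \<bar>int m - int (period K) * int (s + z)\<bar>"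
      using s by (intro visits_far[OF m]) (use 2 in auto)
    ultimately show False
      using eK lK by linarith
  next
    case 3
    obtain s where s: "n = period K * s" "1 \<le> s"
      using visits_multiple[OF n] 3 by blast
    obtain s' where s': "m = period K * s'" "1 \<le> s'"
      using visits_multiple[OF m] 3 by blast
    have "period K * (s + z) + e = period K * s' + l"
      using eq ze s s' by (simp add: algebra_simps)
    then have "s + z = s'" "e = l"
      using mult_add_unique[of "period K" "s + z" e s' l] eK lK dip_less_period[of K] by auto
    moreover have "z \<noteq> 0"
      using \<open>s + z = s'\<close> ne s s' 3 by auto
    ultimately show False
      using ze(3) lK dK by linarith
  qed
qed

text \<open>
  Because \<open>dip 0 = 0\<close>, the separation of the blocks from each other is a special case of \<open>visits_gap\<close>.
\<close>

lemma visits_disjoint: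
  assumes "n \<in> visits p" "m \<in> visits p'" "n \<le> N" "N < n + p" "m \<le> N" "N < m + p'"
  shows "p = p' \<and> n = m"
proof (rule ccontr)
  assume ne: "\<not> ?thesis"
  show False
  proof (cases "n \<le> m")
    case True
    then have "n + (dip 0 + (m - n)) = m + 0" by simp
    then have "2 * max p p' \<le> m - n"
      using assms ne by (intro visits_gap[OF assms(1,2), where k = 0 and l = 0]) auto
    then show False using assms by linarith
  next
    case False
    then have "m + (dip 0 + (n - m)) = n + 0" by simp
    then have "2 * max p' p \<le> n - m"
      using assms ne by (intro visits_gap[OF assms(2,1), where k = 0 and l = 0]) auto
    then show False using assms by linarith
  qed
qed

text \<open>
  The analogue of \<open>visits_gap\<close> seen from time \<open>0\<close>. For \<open>p < k\<close> it uses
  \<open>dip k = dip (k - 1) + period (k - 1)\<close>: shortly after this dip one is close to the first positive multiple of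
  \<open>period (k - 1)\<close>, where block \<open>p\<close> is not allowed.
\<close>

lemma visits_escape:
  assumes m: "m \<in> visits p" and l: "l < p" and eq: "m + l = dip k + t"
  shows "2 * max p (k - 1) \<le> t"
proof (rule ccontr)
  define K where "K = max p (k - 1)"
  assume "\<not> ?thesis"
  then have t: "t < 2 * K" by (simp add: K_def)
  show False
  proof (cases "k \<le> p")
    case True
    then have "K = p" by (auto simp: K_def)
    moreover have "dip k \<le> dip p"
      using True dip_strict_mono by (simp add: strict_mono_less_eq)
    ultimately show False
      using visits_ge[OF m] dip_less_period[of p] eq t by linarith
  next
    case False
    then have K: "k = Suc K" "p \<le> K" by (auto simp: K_def)
    have eqn: "m + l = period K * 1 + (dip K + t)"
      using eq K by (simp add: dip_Suc)
    show False
    proof (cases "p < K")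
      case True
      have "int (dip K + 3 * K) < \<bar>int m - int (period K) * 1\<bar>"
        by (rule visits_far[OF m True]) simp
      then show False
        using arg_cong[OF eqn, of int] t l K by (simp add: algebra_simps)
    next
      case False
      then have "p = K" using K by simp
      obtain s where "m = period K * s"
        using visits_multiple[OF m] \<open>p = K\<close> by blast
      then have "l = dip K + t"
        using mult_add_unique[of "period K" s l 1 "dip K + t"] eqn t l \<open>p = K\<close>
          dip_less_period[of K] by auto
      then show False
        using dip_ge[of K] l \<open>p = K\<close> by linarith
    qed
  qed
qed


section \<open>The visiting times are very frequent\<close>

text \<open>
  At each stage the residue is moved by \<open>5 * period P\<close>, just beyond the neighbourhood of radius
  \<open>4 * period P\<close> of the multiples of \<open>period (Suc P)\<close>. Being a multiple of all earlier periods, this step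
  does not affect the conditions that are already met.
\<close>

lemma avoiding_residue:
  assumes "p \<le> P"
  shows "\<exists>u<period P. period p dvd u \<and>
    (\<forall>k. p \<le> k \<and> k < P \<longrightarrow> (\<forall>s::int. 4 * int (period k) < \<bar>int u - int (period (Suc k)) * s\<bar>))"
  using assms
proof (induction P rule: dec_induct)
  case base
  then show ?case by (intro exI[of _ 0]) auto
next
  case (step P)
  then obtain u where u: "u < period P" "period p dvd u"
    and far: "\<And>k s. p \<le> k \<Longrightarrow> k < P \<Longrightarrow> 4 * int (period k) < \<bar>int u - int (period (Suc k)) * s\<bar>"
    by blast
  define u' where "u' = u + 5 * period P"
  have "4 * int (period k) < \<bar>int u' - int (period (Suc k)) * s\<bar>"
    if k: "p \<le> k" "k < Suc P" for k and s :: int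
  proof (cases "k < P")
    case True
    obtain a where "period P = period (Suc k) * a"
      using period_dvd[of "Suc k" P] True by (auto elim: dvdE)
    then have "int u' - int (period (Suc k)) * s = int u - int (period (Suc k)) * (s - 5 * int a)"
      unfolding u'_def by (simp add: algebra_simps)
    then show ?thesis
      using far[OF k(1) True] by simp
  next
    case False
    then have "k = P" using k by simp
    have ge: "256 * int (period P) \<le> int (period (Suc P))"
      using period_Suc_ge[of P] by linarith
    show ?thesis
    proof (cases "s \<le> 0")
      case True
      then have "int (period (Suc P)) * s \<le> 0"
        by (simp add: mult_le_0_iff)
      then show ?thesis
        using u(1) period_pos[of P] unfolding u'_def \<open>k = P\<close> by linarith
    next
      case False
      then have "int (period (Suc P)) * 1 \<le> int (period (Suc P)) * s"
        by (intro mult_left_mono) auto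
      then show ?thesis
        using u(1) ge period_pos[of P] unfolding u'_def \<open>k = P\<close> by linarith
    qed
  qed
  moreover have "u' < period (Suc P)"
    using u(1) period_Suc_ge[of P] unfolding u'_def by linarith
  moreover have "period p dvd u'"
    unfolding u'_def using u(2) period_dvd[OF step.hyps(1)] by simp
  ultimately show ?case by blast
qed

text \<open>
  The radius is enlarged from \<open>4 * period k\<close> to \<open>6 * period k\<close>, so that a point outside this set keeps
  distance \<open>4 * period k\<close> after a move to the right by at most \<open>2 * period k\<close>.
\<close>

definition forbidden :: "nat \<Rightarrow> nat set" where
  "forbidden k = {m. \<exists>s::int. 1 \<le> s \<and> \<bar>int m - int (period (Suc k)) * s\<bar> \<le> 6 * int (period k)}"

text \<open>
  Each interval of length \<open>2 * period P\<close> contains a time that satisfies the conditions of the stages below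
  \<open>P\<close>, as these are periodic. Starting outside the sets \<open>forbidden k\<close>, it satisfies those of the later
  stages as well.
\<close>

lemma visits_cover:
  assumes "p \<le> P" and m: "\<And>k. P \<le> k \<Longrightarrow> m \<notin> forbidden k"
  shows "\<exists>n\<le>2 * period P. m + n \<in> visits p"
proof -
  obtain u where u: "u < period P" "period p dvd u"
    and far: "\<And>k s. p \<le> k \<Longrightarrow> k < P \<Longrightarrow> 4 * int (period k) < \<bar>int u - int (period (Suc k)) * s\<bar>"
    using avoiding_residue[OF assms(1)] by blast
  define x where "x = u + period P * (m div period P + 1)"
  have "m = period P * (m div period P) + m mod period P"
    by simp
  moreover have "m mod period P < period P"
    by simp
  ultimately have x: "m < x" "x \<le> m + 2 * period P"
    unfolding x_def distrib_left mult_1_right using u(1) by linarith+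
  have "4 * int (period k) < \<bar>int x - int (period (Suc k)) * s\<bar>"
    if k: "p \<le> k" and s: "1 \<le> s" for k and s :: int
  proof (cases "k < P")
    case True
    obtain a where "period P = period (Suc k) * a"
      using period_dvd[of "Suc k" P] True by (auto elim: dvdE)
    then have "int x - int (period (Suc k)) * s
        = int u - int (period (Suc k)) * (s - int (a * (m div period P + 1)))"
      unfolding x_def by (simp add: algebra_simps)
    then show ?thesis
      using far[OF k True] by simp
  next
    case False
    then have "6 * int (period k) < \<bar>int m - int (period (Suc k)) * s\<bar>"
      using m[of k] s by (force simp: forbidden_def)
    moreover have "period P \<le> period k"
      using False by (intro period_mono) simp
    ultimately show ?thesis
      using x by linarith
  qed
  moreover have "period p dvd x"
    unfolding x_def using u(2) period_dvd[OF assms(1)] by simp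
  ultimately have "x \<in> visits p"
    using x by (auto simp: visits_def)
  then show ?thesis
    using x by (intro exI[of _ "x - m"]) auto
qed

text \<open>
  For \<open>M < period k\<close> the first neighbourhood is not yet reached. Otherwise at most
  \<open>7 * M / period (Suc k)\<close> intervals of length at most \<open>13 * period k\<close> matter, and
  \<open>91 \<le> 2 ^ 7\<close> is absorbed by \<open>period (Suc k) = 2 ^ (k + 8) * period k\<close>.
\<close>

lemma forbidden_card:
  "real (card (forbidden k \<inter> {0..M})) \<le> real M / 2 ^ Suc k"
proof (cases "period k \<le> M")
  case False
  have "forbidden k \<inter> {0..M} = {}"
  proof (rule ccontr)
    assume "\<not> ?thesis"
    then obtain m s where m: "m \<le> M" "1 \<le> s" "\<bar>int m - int (period (Suc k)) * s\<bar> \<le> 6 * int (period k)"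
      by (auto simp: forbidden_def)
    have "int (period (Suc k)) * 1 \<le> int (period (Suc k)) * s"
      using m(2) by (intro mult_left_mono) auto
    then show False
      using m False period_Suc_ge[of k] by linarith
  qed
  then show ?thesis by simp
next
  case True
  define S where "S = 7 * M div period (Suc k)"
  define I where "I s = {period (Suc k) * s - 6 * period k..period (Suc k) * s + 6 * period k}" for s
  have "forbidden k \<inter> {0..M} \<subseteq> (\<Union>s\<in>{1..S}. I s)"
  proof
    fix m assume "m \<in> forbidden k \<inter> {0..M}"
    then obtain s where m: "m \<le> M" "1 \<le> s" "\<bar>int m - int (period (Suc k)) * s\<bar> \<le> 6 * int (period k)"
      by (auto simp: forbidden_def)
    define s' where "s' = nat s"
    have s': "s = int s'" "1 \<le> s'" using m(2) by (auto simp: s'_def)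
    have "\<bar>int m - int (period (Suc k) * s')\<bar> \<le> int (6 * period k)"
      using m(3) s' by simp
    then have *: "period (Suc k) * s' \<le> m + 6 * period k" "m \<le> period (Suc k) * s' + 6 * period k"
      by linarith+
    then have "s' * period (Suc k) \<le> 7 * M"
      using True m(1) by (simp add: mult.commute)
    then have "s' \<le> S"
      unfolding S_def by (simp add: less_eq_div_iff_mult_less_eq)
    moreover have "m \<in> I s'"
      unfolding I_def atLeastAtMost_iff using * by linarith
    ultimately show "m \<in> (\<Union>s\<in>{1..S}. I s)"
      using s' by auto
  qed
  then have "card (forbidden k \<inter> {0..M}) \<le> card (\<Union>s\<in>{1..S}. I s)"
    by (intro card_mono) (auto simp: I_def)
  also have "\<dots> \<le> (\<Sum>s\<in>{1..S}. card (I s))"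
    by (rule card_UN_le) simp
  also have "\<dots> \<le> (\<Sum>s\<in>{1..S}. 13 * period k)"
    using period_pos[of k] by (intro sum_mono) (simp add: I_def del: period_pos)
  finally have "card (forbidden k \<inter> {0..M}) \<le> S * (13 * period k)"
    by simp
  then have "real (card (forbidden k \<inter> {0..M})) \<le> real (S * (13 * period k))"
    by (rule of_nat_mono)
  also have "\<dots> = real S * (13 * real (period k))"
    by simp
  also have "\<dots> \<le> real (7 * M) / real (period (Suc k)) * (13 * real (period k))"
    unfolding S_def by (intro mult_right_mono of_nat_div_le_of_nat) simp
  also have "\<dots> = 91 / 128 * (real M / 2 ^ Suc k)"
    using period_pos[of k] by (simp add: period.simps field_simps power_add del: period_pos)
  also have "\<dots> \<le> 1 * (real M / 2 ^ Suc k)"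
    by (intro mult_right_mono) auto
  finally show ?thesis by simp
qed

lemma shift_set_Union: "(\<Union>n\<in>{0..N}. shift_set A n) = {m. \<exists>n\<le>N. m + n \<in> A}"
proof (intro set_eqI iffI)
  fix m assume "m \<in> {m. \<exists>n\<le>N. m + n \<in> A}"
  then obtain n where "n \<le> N" "m + n \<in> A" by auto
  then have "m \<in> shift_set A n"
    by (auto simp: shift_set_def intro!: exI[of _ "m + n"])
  then show "m \<in> (\<Union>n\<in>{0..N}. shift_set A n)"
    using \<open>n \<le> N\<close> by auto
qed (auto simp: shift_set_def)

lemma lower_density_le_1: "lower_density A \<le> 1"
proof -
  have "real (card (A \<inter> {0..N})) / real (N + 1) \<le> 1" for N
    using card_mono[of "{0..N}" "A \<inter> {0..N}"] by simp
  then have "lower_density A \<le> liminf (\<lambda>N. 1)"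
    unfolding lower_density_def by (intro Liminf_mono always_eventually) (simp add: one_ereal_def)
  then show ?thesis by (simp add: Liminf_const)
qed

lemma lower_density_visits_cover:
  assumes "p \<le> P" "2 * period P \<le> N"
  shows "ereal (1 - 1 / 2 ^ P) \<le> lower_density {m. \<exists>n\<le>N. m + n \<in> visits p}" (is "_ \<le> lower_density ?C")
proof -
  have "1 - 1 / 2 ^ P \<le> real (card (?C \<inter> {0..M})) / real (M + 1)" for M
  proof -
    have "{0..M} - ?C \<subseteq> (\<Union>k\<in>{P..<P + M}. forbidden k \<inter> {0..M})"
    proof
      fix m assume m: "m \<in> {0..M} - ?C"
      have "\<exists>k\<ge>P. m \<in> forbidden k"
      proof (rule ccontr)
        assume "\<not> ?thesis"
        then obtain n where "n \<le> 2 * period P" "m + n \<in> visits p"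
          using visits_cover[OF assms(1), of m] by blast
        then show False
          using m assms(2) by (auto dest: order_trans)
      qed
      then obtain k where k: "k \<ge> P" "m \<in> forbidden k" by blast
      have "card (forbidden k \<inter> {0..M}) \<noteq> 0"
        using m k by auto
      then have "1 \<le> real (card (forbidden k \<inter> {0..M}))"
        by linarith
      then have "1 \<le> real M / 2 ^ Suc k"
        using forbidden_card[of k M] by linarith
      then have "2 ^ Suc k \<le> real M"
        by (simp add: field_simps)
      then have "2 ^ Suc k \<le> M"
        by (metis of_nat_le_iff of_nat_numeral of_nat_power)
      moreover have "Suc k < 2 ^ Suc k"
        by (rule less_exp)
      ultimately have "k < P + M"
        by linarith
      then show "m \<in> (\<Union>k\<in>{P..<P + M}. forbidden k \<inter> {0..M})"
        using k m by auto
    qed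
    then have "card ({0..M} - ?C) \<le> card (\<Union>k\<in>{P..<P + M}. forbidden k \<inter> {0..M})"
      by (intro card_mono) auto
    also have "\<dots> \<le> (\<Sum>k\<in>{P..<P + M}. card (forbidden k \<inter> {0..M}))"
      by (rule card_UN_le) simp
    finally have "real (card ({0..M} - ?C)) \<le> real (\<Sum>k\<in>{P..<P + M}. card (forbidden k \<inter> {0..M}))"
      by (rule of_nat_mono)
    also have "\<dots> \<le> (\<Sum>k\<in>{P..<P + M}. real M / 2 ^ Suc k)"
      unfolding of_nat_sum by (intro sum_mono forbidden_card)
    also have "\<dots> = real M * (1 / 2 ^ P - 1 / 2 ^ (P + M))"
    proof -
      have "(\<Sum>k\<in>{P..<P + L}. real M / 2 ^ Suc k) = real M * (1 / 2 ^ P - 1 / 2 ^ (P + L))" for L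
      proof (induction L)
        case (Suc L)
        have "(\<Sum>k\<in>{P..<P + Suc L}. real M / 2 ^ Suc k)
            = (\<Sum>k\<in>{P..<P + L}. real M / 2 ^ Suc k) + real M / 2 ^ Suc (P + L)"
          by simp
        then show ?case
          unfolding Suc.IH by (simp add: right_diff_distrib)
      qed simp
      then show ?thesis by blast
    qed
    also have "\<dots> \<le> (real M + 1) * (1 / 2 ^ P)"
      by (intro mult_mono) (auto intro!: divide_left_mono power_increasing)
    finally have "real (card ({0..M} - ?C)) \<le> (real M + 1) * (1 / 2 ^ P)" .
    moreover have "real (card (?C \<inter> {0..M})) + real (card ({0..M} - ?C)) = real M + 1"
    proof -
      have "card ({0..M} \<inter> ?C) + card ({0..M} - ?C) = card {0..M}"
        by (subst card_Un_disjoint[symmetric]) (auto simp: Int_Diff_Un)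
      then show ?thesis
        by (simp add: Int_commute flip: of_nat_add)
    qed
    ultimately have "(real M + 1) - (real M + 1) * (1 / 2 ^ P) \<le> real (card (?C \<inter> {0..M}))"
      by linarith
    then have "(1 - 1 / 2 ^ P) * (real M + 1) \<le> real (card (?C \<inter> {0..M}))"
      by (simp only: left_diff_distrib mult_1_left mult.commute[of "1 / 2 ^ P"])
    then show ?thesis
      by (simp add: pos_le_divide_eq add.commute)
  qed
  then show ?thesis
    unfolding lower_density_def by (intro Liminf_bounded always_eventually) simp
qed

lemma visits_Hin: "visits p \<in> Hin"
proof -
  define D where "D N = lower_density {m. \<exists>n\<le>N. m + n \<in> visits p}" for N
  have "D \<longlonglongrightarrow> 1"
  proof (rule order_tendstoI)
    fix a :: ereal assume "a < 1"
    have "(\<lambda>P. 1 - 1 / 2 ^ P :: real) \<longlonglongrightarrow> 1 - 0"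
      by (intro tendsto_intros LIMSEQ_divide_realpow_zero) auto
    then have "(\<lambda>P. ereal (1 - 1 / 2 ^ P)) \<longlonglongrightarrow> 1"
      by (simp add: one_ereal_def)
    then have "\<forall>\<^sub>F P in sequentially. a < ereal (1 - 1 / 2 ^ P)"
      using \<open>a < 1\<close> by (rule order_tendstoD)
    then have "\<forall>\<^sub>F P in sequentially. p \<le> P \<and> a < ereal (1 - 1 / 2 ^ P)"
      by (intro eventually_conj eventually_ge_at_top)
    then obtain P where P: "p \<le> P" "a < ereal (1 - 1 / 2 ^ P)"
      by (auto simp: eventually_sequentially)
    have "a < D N" if "2 * period P \<le> N" for N
      unfolding D_def using less_le_trans[OF P(2) lower_density_visits_cover[OF P(1) that]] .
    then show "\<forall>\<^sub>F N in sequentially. a < D N"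
      by (auto simp: eventually_sequentially)
  next
    fix a :: ereal assume "1 < a"
    then show "\<forall>\<^sub>F N in sequentially. D N < a"
      unfolding D_def by (intro always_eventually allI le_less_trans[OF lower_density_le_1])
  qed
  then show ?thesis
    by (simp add: Hin_def shift_set_Union D_def[abs_def])
qed

lemma lower_density_mono: "A \<subseteq> B \<Longrightarrow> lower_density A \<le> lower_density B"
  unfolding lower_density_def
  by (intro Liminf_mono always_eventually allI)
    (auto intro!: divide_right_mono of_nat_mono card_mono)

lemma Hin_superset:
  assumes "A \<in> Hin" "A \<subseteq> B"
  shows "B \<in> Hin"
proof -
  have "(\<lambda>N. lower_density {m. \<exists>n\<le>N. m + n \<in> B}) \<longlonglongrightarrow> 1"
  proof (rule tendsto_sandwich)
    show "(\<lambda>N. lower_density {m. \<exists>n\<le>N. m + n \<in> A}) \<longlonglongrightarrow> 1"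
      using assms(1) by (simp add: Hin_def shift_set_Union)
    show "\<forall>\<^sub>F N in sequentially. lower_density {m. \<exists>n\<le>N. m + n \<in> A} \<le> lower_density {m. \<exists>n\<le>N. m + n \<in> B}"
      using assms(2) by (intro always_eventually allI lower_density_mono) auto
  qed (auto intro!: always_eventually lower_density_le_1)
  then show ?thesis
    by (simp add: Hin_def shift_set_Union)
qed

section \<open>The weight and its dips\<close>

primrec since_dip :: "nat \<Rightarrow> nat" where
  "since_dip 0 = 0"
| "since_dip (Suc n) = (if Suc n \<in> range dip then 0 else Suc (since_dip n))"

lemma since_dip_dip [simp]: "since_dip (dip k) = 0"
  by (cases "dip k") (simp_all, metis rangeI)

lemma since_dip_decomposition:
  obtains k where "n = dip k + since_dip n" "n < dip (Suc k)"
proof -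
  have "\<exists>k. n = dip k + since_dip n \<and> n < dip (Suc k)"
  proof (induction n)
    case 0
    then show ?case by (intro exI[of _ 0]) (simp add: dip_Suc)
  next
    case (Suc n)
    then obtain k where k: "n = dip k + since_dip n" "n < dip (Suc k)" by blast
    show ?case
    proof (cases "Suc n = dip (Suc k)")
      case True
      then show ?thesis
        using dip_Suc[of "Suc k"] by (intro exI[of _ "Suc k"]) simp
    next
      case False
      have less: "Suc n < dip (Suc k)"
        using k False by linarith
      have "Suc n \<noteq> dip j" for j
      proof
        assume "Suc n = dip j"
        then have "dip k < dip j" "dip j < dip (Suc k)"
          using k less by linarith+
        then show False
          using dip_strict_mono by (simp add: strict_mono_less)
      qed
      then show ?thesis
        using k less by (intro exI[of _ k]) auto
    qed
  qed
  then show thesis using that by blast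
qed

lemma since_dip_add_le: "since_dip (n + j) \<le> since_dip n + j"
  by (induction j) auto

definition growth :: "nat \<Rightarrow> real" where
  "growth n = 2 ^ since_dip n"

lemma growth_pos [simp]: "0 < growth n"
  by (simp add: growth_def)

lemma growth_nonzero [simp]: "growth n \<noteq> 0"
  using growth_pos[of n] by linarith

lemma growth_dip [simp]: "growth (dip k) = 1"
  by (simp add: growth_def)

lemma growth_0 [simp]: "growth 0 = 1"
  by (simp add: growth_def)

lemma growth_add_le: "growth (n + j) \<le> growth n * 2 ^ j"
  unfolding growth_def power_add[symmetric] by (rule power_increasing[OF since_dip_add_le]) simp

definition dip_weight :: "nat \<Rightarrow> 'k::real_normed_field" where
  "dip_weight n = of_real (growth n / growth (n - 1))"

lemma dip_weight_nonzero: "dip_weight n \<noteq> 0"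
  by (simp add: dip_weight_def)

lemma dip_weight_bounded: "bounded (dip_weight ` {1..})"
proof -
  have "norm (dip_weight n :: 'a) \<le> 2" if "n \<ge> 1" for n
    using growth_add_le[of "n - 1" 1] that
    by (simp add: dip_weight_def field_simps norm_divide less_imp_le)
  then show ?thesis
    by (auto simp: bounded_iff)
qed

abbreviation dip_shift :: "'k::real_normed_field c0 \<Rightarrow> 'k c0" where
  "dip_shift \<equiv> weighted_shift dip_weight"

lemma dip_shift_funpow:
  "c0_nth ((dip_shift ^^ n) x) i = of_real (growth (n + i) / growth i) * c0_nth x (n + i)"
proof (induction n arbitrary: i)
  case (Suc n)
  have "c0_nth ((dip_shift ^^ Suc n) x) i = dip_weight (Suc i) * c0_nth ((dip_shift ^^ n) x) (Suc i)"
    by (simp add: weighted_shift_nth[OF dip_weight_bounded])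
  also have "\<dots> = of_real (growth (Suc i) / growth i * (growth (n + Suc i) / growth (Suc i))) * c0_nth x (n + Suc i)"
    unfolding Suc.IH dip_weight_def by (simp only: of_real_mult mult.assoc diff_Suc_1)
  also have "\<dots> = of_real (growth (Suc n + i) / growth i) * c0_nth x (Suc n + i)"
    by simp
  finally show ?case .
qed simp

text \<open>
  The source of every negative property of the shift.
\<close>

lemma dip_shift_funpow_dip: "c0_nth ((dip_shift ^^ dip k) x) 0 = c0_nth x (dip k)"
  by (simp add: dip_shift_funpow)

lemma c0_nth_dip_tendsto: "(\<lambda>k. c0_nth x (dip k)) \<longlonglongrightarrow> 0"
  using LIMSEQ_subseq_LIMSEQ[OF c0_tendsto dip_strict_mono] by (simp add: o_def)

lemma dip_shift_eq_0:
  assumes "\<And>n. c0_nth ((dip_shift ^^ n) x) 0 = 0"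
  shows "x = 0"
proof (rule c0_eqI)
  fix n
  have "of_real (growth n) * c0_nth x n = 0"
    using assms[of n] by (simp add: dip_shift_funpow)
  then show "c0_nth x n = c0_nth 0 n"
    by (simp add: zero_c0.rep_eq)
qed


section \<open>Consequences of the dips\<close>

lemma continuous_c0_nth: "continuous_on UNIV (\<lambda>x. c0_nth x n)"
proof -
  have "bounded_linear (\<lambda>x :: 'a c0. c0_nth x n)"
    by (rule bounded_linear_intro[where K = 1])
      (simp_all add: plus_c0.rep_eq scaleR_c0.rep_eq norm_nth_le_c0)
  then show ?thesis
    by (rule linear_continuous_on)
qed

lemma continuous_dip_shift_funpow: "continuous_on UNIV (dip_shift ^^ n)"
proof (induction n)
  case (Suc n)
  then show ?case
    using continuous_on_compose2[OF weighted_shift_operator(2)[OF dip_weight_bounded] Suc]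
    by (simp add: comp_def)
qed (simp add: id_def)

lift_definition c0_unit :: "'k::real_normed_field \<Rightarrow> 'k c0" is "\<lambda>c n. if n = 0 then c else 0"
proof -
  fix c :: 'k
  have "\<forall>\<^sub>F n in sequentially. (if n = 0 then c else 0) = 0"
    by (auto simp: eventually_sequentially intro: exI[of _ 1])
  then show "(\<lambda>n. if n = 0 then c else 0) \<longlonglongrightarrow> 0"
    by (rule tendsto_eventually)
qed

lemma dip_shift_no_unimodular_eigenvalue:
  fixes c :: "'k::real_normed_field"
  assumes "norm c = 1"
  shows "\<not> eigenvalue dip_shift c"
proof
  assume "eigenvalue dip_shift c"
  then obtain x where x: "x \<noteq> 0" "dip_shift x = c *\<^sub>K x"
    by (auto simp: eigenvalue_def)
  have lin: "dip_shift (a *\<^sub>K x) = a *\<^sub>K dip_shift x" for a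
    by (rule c0_eqI) (simp add: weighted_shift_nth[OF dip_weight_bounded] scaleK.rep_eq algebra_simps)
  have pow: "(dip_shift ^^ n) x = c ^ n *\<^sub>K x" for n
    by (induction n) (auto simp: lin x(2) scaleK.rep_eq intro!: c0_eqI)
  have "norm (c0_nth x (dip k)) = norm (c0_nth x 0)" for k
    by (simp add: pow scaleK.rep_eq norm_mult norm_power assms flip: dip_shift_funpow_dip)
  then have "(\<lambda>k::nat. norm (c0_nth x 0)) \<longlonglongrightarrow> 0"
    using tendsto_norm[OF c0_nth_dip_tendsto[of x]] by simp
  then have "c0_nth x 0 = 0"
    by (simp add: LIMSEQ_const_iff)
  then have "x = 0"
    by (intro dip_shift_eq_0) (simp add: pow scaleK.rep_eq)
  then show False using x by simp
qed

lemma dip_shift_not_mixing: "\<not> mixing (dip_shift :: 'k::real_normed_field c0 \<Rightarrow> 'k c0)"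
proof
  assume mix: "mixing (dip_shift :: 'k c0 \<Rightarrow> 'k c0)"
  define U :: "'k c0 set" where "U = ball 0 1"
  define V :: "'k c0 set" where "V = {x. 1 < norm (c0_nth x 0)}"
  have "open V"
    unfolding V_def by (intro open_Collect_less continuous_intros continuous_c0_nth)
  moreover have "c0_unit 2 \<in> V"
    by (simp add: V_def c0_unit.rep_eq)
  moreover have "open U" "0 \<in> U"
    by (auto simp: U_def)
  ultimately obtain N where N: "\<And>n. n \<ge> N \<Longrightarrow> (dip_shift ^^ n) ` U \<inter> V \<noteq> {}"
    using mix unfolding mixing_def by blast
  then obtain x where x: "x \<in> U" "(dip_shift ^^ dip N) x \<in> V"
    using N[OF dip_ge] by auto
  then have "1 < norm (c0_nth x (dip N))"
    by (simp add: V_def dip_shift_funpow_dip)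
  also have "\<dots> \<le> norm x"
    by (rule norm_nth_le_c0)
  finally show False
    using x by (simp add: U_def)
qed

text \<open>
  If \<open>n\<close> is a period of \<open>x\<close>, then \<open>growth m * x m = x 0\<close> at every multiple \<open>m\<close> of \<open>n\<close>. After each dip
  there is such a multiple within \<open>n\<close> steps, where \<open>growth m \<le> 2 ^ n\<close>; so \<open>x m\<close> does not tend to \<open>0\<close> unless
  \<open>x 0 = 0\<close>.
\<close>

lemma dip_shift_periodic_point:
  assumes "n \<ge> 1" "(dip_shift ^^ n) x = x"
  shows "c0_nth x 0 = 0"
proof (rule ccontr)
  assume "c0_nth x 0 \<noteq> 0"
  then have "0 < norm (c0_nth x 0) / 2 ^ n" by simp
  then obtain M where M: "\<And>m. m \<ge> M \<Longrightarrow> norm (c0_nth x m) < norm (c0_nth x 0) / 2 ^ n"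
    using LIMSEQ_D[OF c0_tendsto[of x]] by fastforce
  have "(dip_shift ^^ (n * j)) x = x" for j
    using assms(2) by (induction j) (simp_all add: funpow_add)
  then have x0: "c0_nth x 0 = of_real (growth (n * j)) * c0_nth x (n * j)" for j
    using dip_shift_funpow[of "n * j" x 0] by simp
  define j where "j = Suc (dip M div n)"
  have "dip M = n * (dip M div n) + dip M mod n" "dip M mod n < n"
    using assms(1) by auto
  then have "dip M < n * j" "n * j \<le> dip M + n"
    unfolding j_def mult_Suc_right by linarith+
  then have nj: "dip M \<le> n * j" "n * j - dip M \<le> n" by auto
  have "growth (dip M + (n * j - dip M)) \<le> growth (dip M) * 2 ^ (n * j - dip M)"
    by (rule growth_add_le)
  also have "\<dots> \<le> 2 ^ n"
    using nj by (simp add: power_increasing)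
  finally have g: "growth (n * j) \<le> 2 ^ n"
    using nj by simp
  have "norm (c0_nth x 0) = growth (n * j) * norm (c0_nth x (n * j))"
    using arg_cong[OF x0[of j], of norm] by (simp add: norm_mult less_imp_le)
  also have "\<dots> \<le> 2 ^ n * norm (c0_nth x (n * j))"
    using g by (intro mult_right_mono) auto
  also have "\<dots> < norm (c0_nth x 0)"
    using M[of "n * j"] nj(1) dip_ge[of M] by (simp add: field_simps)
  finally show False by simp
qed

lemma dip_shift_not_chaotic: "\<not> chaotic (dip_shift :: 'k::real_normed_field c0 \<Rightarrow> 'k c0)"
proof
  define V :: "'k c0 set" where "V = {x. 0 < norm (c0_nth x 0)}"
  assume "chaotic (dip_shift :: 'k c0 \<Rightarrow> 'k c0)"
  then have "c0_unit 1 \<in> closure (periodic_points (dip_shift :: 'k c0 \<Rightarrow> 'k c0))"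
    by (simp add: chaotic_def)
  moreover have "open V"
    unfolding V_def by (intro open_Collect_less continuous_intros continuous_c0_nth)
  moreover have "c0_unit 1 \<in> V"
    by (simp add: V_def c0_unit.rep_eq)
  ultimately obtain x where "x \<in> V" "x \<in> periodic_points dip_shift"
    by (meson closure_iff_nhds_not_empty disjoint_iff order_refl)
  then show False
    using dip_shift_periodic_point by (auto simp: V_def periodic_points_def)
qed

text \<open>
  By invariance, coordinate \<open>0\<close> is at least \<open>e\<close> in norm with the same probability as coordinate \<open>dip k\<close>.
  As the latter tends to \<open>0\<close> pointwise, this probability is \<open>0\<close>. Applying invariance once more, coordinate \<open>0\<close>
  vanishes almost surely along the whole orbit, which forces the point to be \<open>0\<close>.
\<close>

lemma dip_shift_invariant_measure:
  fixes M :: "'k::real_normed_field c0 measure"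
  assumes "prob_space M" and sets: "sets M = sets borel" and inv: "invariant_measure dip_shift M"
  shows "M = return borel 0"
proof -
  interpret prob_space M by fact
  have space: "space M = UNIV"
    using sets_eq_imp_space_eq[OF sets] by simp
  have meas_T: "dip_shift ^^ n \<in> measurable M borel" for n
    using borel_measurable_continuous_onI[OF continuous_dip_shift_funpow]
    by (simp add: measurable_cong_sets[OF sets refl])
  have inv_n: "distr M borel (dip_shift ^^ n) = M" for n
  proof (induction n)
    case 0
    have "distr M borel id = distr M M id"
      by (rule distr_cong) (simp_all add: sets)
    then show ?case by (simp add: id_def)
  next
    case (Suc n)
    have T: "dip_shift \<in> measurable borel borel"
      using weighted_shift_operator(2)[OF dip_weight_bounded] by (rule borel_measurable_continuous_onI)
    have "distr M borel (dip_shift ^^ Suc n) = distr (distr M borel (dip_shift ^^ n)) borel dip_shift"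
      unfolding funpow.simps(2) by (rule distr_distr[OF T meas_T, symmetric])
    also have "\<dots> = M"
      using Suc inv by (simp add: invariant_measure_def)
    finally show ?case .
  qed
  have measure_inv: "measure M {x. (dip_shift ^^ n) x \<in> S} = measure M S" if "S \<in> sets borel" for n S
    using measure_distr[OF meas_T that, of n] by (simp add: inv_n space vimage_def)
  have nth_ge: "{x. e \<le> norm (c0_nth x n)} \<in> sets borel" for e n
    by (intro borel_closed closed_Collect_le continuous_intros continuous_c0_nth)
  have null_ge: "measure M {x. e \<le> norm (c0_nth x 0)} = 0" if "e > 0" for e
  proof -
    define S where "S j = (\<Union>k\<in>{j..}. {x :: 'k c0. e \<le> norm (c0_nth x (dip k))})" for j
    have S: "range S \<subseteq> sets M"
      unfolding S_def sets by (intro image_subsetI sets.countable_UN'' nth_ge) auto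
    have "(\<Inter>j. S j) = {}"
    proof (rule equals0I)
      fix x assume x: "x \<in> (\<Inter>j. S j)"
      obtain k0 where "\<And>k. k \<ge> k0 \<Longrightarrow> norm (c0_nth x (dip k)) < e"
        using LIMSEQ_D[OF c0_nth_dip_tendsto[of x] \<open>e > 0\<close>] by auto
      then show False
        using x by (force simp: S_def)
    qed
    moreover have "decseq S"
      by (force simp: S_def decseq_def)
    ultimately have lim: "(\<lambda>j. measure M (S j)) \<longlonglongrightarrow> 0"
      using finite_Lim_measure_decseq[OF S] by simp
    have "measure M {x. e \<le> norm (c0_nth x 0)} \<le> measure M (S j)" for j
    proof -
      have "measure M {x. e \<le> norm (c0_nth x 0)} = measure M {x. e \<le> norm (c0_nth x (dip j))}"
        using measure_inv[OF nth_ge[of e 0], of "dip j"] by (simp add: dip_shift_funpow_dip)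
      also have "\<dots> \<le> measure M (S j)"
        using S by (intro finite_measure_mono) (auto simp: S_def)
      finally show ?thesis .
    qed
    then have "measure M {x. e \<le> norm (c0_nth x 0)} \<le> 0"
      by (intro tendsto_lowerbound[OF lim]) auto
    then show ?thesis
      using measure_nonneg[of M "{x. e \<le> norm (c0_nth x 0)}"] by linarith
  qed
  have null_ge_n: "AE x in M. \<not> 1 / real (Suc m) \<le> norm (c0_nth ((dip_shift ^^ n) x) 0)" for m n
  proof -
    have "measure M {x. 1 / real (Suc m) \<le> norm (c0_nth ((dip_shift ^^ n) x) 0)} = 0"
      using measure_inv[OF nth_ge[of "1 / real (Suc m)" 0], of n] null_ge[of "1 / real (Suc m)"] by simp
    moreover have "{x. 1 / real (Suc m) \<le> norm (c0_nth ((dip_shift ^^ n) x) 0)} \<in> sets M"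
      using measurable_sets[OF meas_T[of n] nth_ge[of "1 / real (Suc m)" 0]] by (simp add: space vimage_def)
    ultimately show ?thesis
      by (intro AE_I[where N = "{x. 1 / real (Suc m) \<le> norm (c0_nth ((dip_shift ^^ n) x) 0)}"])
        (auto simp: emeasure_eq_measure)
  qed
  have "AE x in M. \<forall>n m. \<not> 1 / real (Suc m) \<le> norm (c0_nth ((dip_shift ^^ n) x) 0)"
    unfolding AE_all_countable by (intro allI null_ge_n)
  then have AE0: "AE x in M. x = 0"
  proof eventually_elim
    case (elim x)
    show ?case
    proof (rule dip_shift_eq_0, rule ccontr)
      fix n assume "c0_nth ((dip_shift ^^ n) x) 0 \<noteq> 0"
      then obtain m where "1 / real (Suc m) < norm (c0_nth ((dip_shift ^^ n) x) 0)"
        using reals_Archimedean[of "norm (c0_nth ((dip_shift ^^ n) x) 0)"]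
        by (auto simp: inverse_eq_divide)
      then show False using elim by (auto dest: less_imp_le)
    qed
  qed
  show ?thesis
  proof (rule measure_eqI)
    fix A assume A: "A \<in> sets M"
    have "emeasure M A = emeasure M (if 0 \<in> A then space M else {})"
      using AE0 A by (intro emeasure_eq_AE) (auto elim: eventually_mono)
    then show "emeasure M A = emeasure (return borel 0) A"
      using A sets by (simp add: emeasure_space_1)
  qed (simp add: sets)
qed

section \<open>A vector built from blocks\<close>

text \<open>
  At every position the sum has at most one term by \<open>visits_disjoint\<close>; it serves as a case distinction with
  default value \<open>0\<close>.
\<close>

definition block_sequence :: "(nat \<Rightarrow> nat \<Rightarrow> 'k) \<Rightarrow> nat \<Rightarrow> 'k::real_normed_field" where
  "block_sequence b N = (\<Sum>(p, m) | m \<in> visits p \<and> m \<le> N \<and> N < m + p. b p (N - m))"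

lemma block_sequence_eq:
  assumes "m \<in> visits p" "l < p"
  shows "block_sequence b (m + l) = b p l"
proof -
  have "{(p', m'). m' \<in> visits p' \<and> m' \<le> m + l \<and> m + l < m' + p'} = {(p, m)}"
  proof (intro set_eqI iffI)
    fix z assume "z \<in> {(p', m'). m' \<in> visits p' \<and> m' \<le> m + l \<and> m + l < m' + p'}"
    then obtain p' m' where z: "z = (p', m')" "m' \<in> visits p'" "m' \<le> m + l" "m + l < m' + p'"
      by blast
    have "p = p' \<and> m = m'"
      using z assms by (intro visits_disjoint[of m p m' p' "m + l"]) auto
    then show "z \<in> {(p, m)}" using z by simp
  qed (use assms in simp)
  then show ?thesis
    by (simp add: block_sequence_def)
qed

lemma block_sequence_cases:
  obtains (zero) "block_sequence b N = 0"
  | (block) p m l where "m \<in> visits p" "l < p" "N = m + l" "block_sequence b N = b p l"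
proof (cases "\<exists>p m. m \<in> visits p \<and> m \<le> N \<and> N < m + p")
  case True
  then obtain p m where *: "m \<in> visits p" "m \<le> N" "N < m + p" by blast
  define l where "l = N - m"
  have "l < p" "N = m + l" using * by (auto simp: l_def)
  then show ?thesis
    using * block_sequence_eq[of m p l b] by (intro block[of m p l]) simp_all
next
  case False
  then have "{(p, m). m \<in> visits p \<and> m \<le> N \<and> N < m + p} = {}" by auto
  then show ?thesis
    by (intro zero) (simp only: block_sequence_def sum.empty)
qed

lemma mult_Suc_le_power: "K * Suc K \<le> 2 ^ (2 * K)"
proof -
  have "Suc K \<le> 2 ^ K"
    using less_exp[of K] by linarith
  then have "K * Suc K \<le> 2 ^ K * 2 ^ K"
    by (intro mult_mono) auto
  then show ?thesis
    by (simp add: mult_2 power_add)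
qed

text \<open>
  The bookkeeping of sizes: \<open>2 * K\<close> steps of doubling outweigh a block entry of norm at most \<open>K\<close> with a
  factor \<open>K + 1\<close> to spare, and this factor gives the accuracy of the approximation.
\<close>

lemma le_growth_over_Suc:
  assumes "p \<le> K" "c \<le> real p" "2 * K \<le> since_dip n"
  shows "c \<le> growth n / real (Suc K)"
proof -
  have "c * real (Suc K) \<le> real K * real (Suc K)"
    using assms by (intro mult_right_mono) auto
  also have "\<dots> = real (K * Suc K)"
    by (rule of_nat_mult[symmetric])
  also have "\<dots> \<le> real (2 ^ (2 * K))"
    using mult_Suc_le_power by (rule of_nat_mono)
  also have "\<dots> \<le> growth n"
    unfolding growth_def of_nat_power of_nat_numeral using assms by (intro power_increasing) auto
  finally show ?thesis
    by (simp add: pos_le_divide_eq)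
qed

lemma block_sequence_tail:
  assumes b: "\<And>p l. norm (b p l) \<le> real p" and n: "n \<in> visits p" and i: "p \<le> i"
  shows "norm (block_sequence b (n + i)) \<le> growth i / real (Suc p)"
proof (cases rule: block_sequence_cases[of b "n + i"])
  case zero
  then show ?thesis by (simp add: less_imp_le)
next
  case (block p' m l)
  obtain k where k: "i = dip k + since_dip i"
    by (rule since_dip_decomposition)
  have "n + (dip k + since_dip i) = m + l"
    using block(3) k by linarith
  then have "2 * max p p' \<le> since_dip i"
    using block i by (intro visits_gap[OF n block(1,2)]) auto
  then have "norm (b p' l) \<le> growth i / real (Suc (max p p'))"
    using b by (intro le_growth_over_Suc[of p']) auto
  also have "\<dots> \<le> growth i / real (Suc p)"
    by (intro divide_left_mono) (auto simp: less_imp_le)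
  finally show ?thesis
    using block by simp
qed

lemma block_sequence_tendsto:
  assumes b: "\<And>p l. norm (b p l) \<le> real p"
  shows "(\<lambda>n. block_sequence b n / of_real (growth n)) \<longlonglongrightarrow> 0"
proof (rule LIMSEQ_I)
  fix r :: real assume "r > 0"
  then obtain j where j: "1 / real (Suc j) < r"
    using reals_Archimedean[of r] by (auto simp: inverse_eq_divide)
  have "norm (block_sequence b n) \<le> growth n / real (Suc j)" if n: "dip (Suc j) \<le> n" for n
  proof (cases rule: block_sequence_cases[of b n])
    case zero
    then show ?thesis by (simp add: less_imp_le)
  next
    case (block p m l)
    obtain k where k: "n = dip k + since_dip n" "n < dip (Suc k)"
      by (rule since_dip_decomposition)
    have "dip (Suc j) < dip (Suc k)"
      using k n by linarith
    then have "j < k"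
      using dip_strict_mono by (simp add: strict_mono_less)
    have "m + l = dip k + since_dip n"
      using block(3) k(1) by linarith
    then have "2 * max p (k - 1) \<le> since_dip n"
      by (rule visits_escape[OF block(1,2)])
    then have "norm (b p l) \<le> growth n / real (Suc (max p (k - 1)))"
      using b by (intro le_growth_over_Suc[of p]) auto
    also have "\<dots> \<le> growth n / real (Suc j)"
      using \<open>j < k\<close> by (intro divide_left_mono) (auto simp: less_imp_le)
    finally show ?thesis
      using block by simp
  qed
  then have "norm (block_sequence b n / of_real (growth n)) \<le> 1 / real (Suc j)" if "dip (Suc j) \<le> n" for n
    using that by (simp add: norm_divide less_imp_le pos_divide_le_eq)
  then show "\<exists>N. \<forall>n\<ge>N. norm (block_sequence b n / of_real (growth n) - 0) < r"
    using j by (auto intro!: exI[of _ "dip (Suc j)"] le_less_trans[OF _ j])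
qed

text \<open>
  At a visiting time of block \<open>p\<close> the orbit of the vector \<open>x\<close> shows this block in its first \<open>p\<close>
  coordinates, rescaled by \<open>growth\<close>, and is small in all the others.
\<close>

lemma block_orbit:
  fixes b :: "nat \<Rightarrow> nat \<Rightarrow> 'k::real_normed_field"
  assumes b: "\<And>p l. norm (b p l) \<le> real p"
  obtains x :: "'k c0" where
    "\<And>p n i. n \<in> visits p \<Longrightarrow> i < p \<Longrightarrow> c0_nth ((dip_shift ^^ n) x) i = b p i / of_real (growth i)"
    "\<And>p n i. n \<in> visits p \<Longrightarrow> p \<le> i \<Longrightarrow> norm (c0_nth ((dip_shift ^^ n) x) i) \<le> 1 / real (Suc p)"
proof -
  define x where "x = Abs_c0 (\<lambda>n. block_sequence b n / of_real (growth n))"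
  have x: "c0_nth x n = block_sequence b n / of_real (growth n)" for n
    unfolding x_def using block_sequence_tendsto[of b] b by (simp add: Abs_c0_inverse)
  have orbit: "c0_nth ((dip_shift ^^ n) x) i = block_sequence b (n + i) / of_real (growth i)" for n i
    by (simp add: dip_shift_funpow x)
  show thesis
  proof (rule that)
    show "c0_nth ((dip_shift ^^ n) x) i = b p i / of_real (growth i)" if "n \<in> visits p" "i < p" for p n i
      using that by (simp add: orbit block_sequence_eq)
    show "norm (c0_nth ((dip_shift ^^ n) x) i) \<le> 1 / real (Suc p)" if "n \<in> visits p" "p \<le> i" for p n i
      using block_sequence_tail[of b n p i] b that
      by (simp add: orbit norm_divide less_imp_le pos_divide_le_eq)
  qed
qed

lemma every_list_infinitely_often:
  assumes "countable D"
  obtains f :: "nat \<Rightarrow> 'a list" where "\<And>xs N. xs \<in> lists D \<Longrightarrow> \<exists>p\<ge>N. f p = xs"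
proof
  fix xs and N :: nat assume xs: "xs \<in> lists D"
  obtain i where i: "from_nat_into (lists D) i = xs"
    using from_nat_into_surj[OF countable_lists[OF assms] xs] ..
  show "\<exists>p\<ge>N. from_nat_into (lists D) (fst (prod_decode p)) = xs"
    by (intro exI[of _ "prod_encode (i, N)"]) (simp add: i le_prod_encode_2)
qed

text \<open>
  The blocks run through the finite lists over a countable dense set of scalars, each of them infinitely often.
  Therefore the entries of block \<open>p\<close> may be required to have norm at most \<open>p\<close>: a given list is recovered in
  full as soon as \<open>p\<close> is large.
\<close>

lemma dip_shift_very_frequently_hypercyclic:
  "very_frequently_hypercyclic (dip_shift :: 'k::{real_normed_field, second_countable_topology} c0 \<Rightarrow> 'k c0)"
proof -
  obtain D :: "'k set" where D: "countable D" "\<And>X. open X \<Longrightarrow> X \<noteq> {} \<Longrightarrow> \<exists>d\<in>D. d \<in> X"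
    using countable_dense_exists by blast
  obtain f :: "nat \<Rightarrow> 'k list" where f: "\<And>xs N. xs \<in> lists D \<Longrightarrow> \<exists>p\<ge>N. f p = xs"
    using every_list_infinitely_often[OF D(1)] by blast
  define b where "b p l = (if l < length (f p) \<and> norm (f p ! l) \<le> real p then f p ! l else 0)" for p l
  have "norm (b p l) \<le> real p" for p l
    by (simp add: b_def)
  then obtain x where
    x: "\<And>p n i. n \<in> visits p \<Longrightarrow> i < p \<Longrightarrow> c0_nth ((dip_shift ^^ n) x) i = b p i / of_real (growth i)"
      "\<And>p n i. n \<in> visits p \<Longrightarrow> p \<le> i \<Longrightarrow> norm (c0_nth ((dip_shift ^^ n) x) i) \<le> 1 / real (Suc p)"
    using block_orbit[of b] by blast
  have "{n. (dip_shift ^^ n) x \<in> U} \<in> Hin" if U: "open U" "U \<noteq> {}" for U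
  proof -
    obtain z where "z \<in> U" using U(2) by blast
    then obtain e where z: "e > 0" "\<And>z'. dist z' z < e \<Longrightarrow> z' \<in> U"
      using U(1) unfolding open_dist by blast
    \<comment> \<open>Each coordinate deviates from \<open>z\<close> by at most \<open>2 * \<delta>\<close>: once for the orbit, once for the tail of \<open>z\<close>.\<close>
    define \<delta> where "\<delta> = e / 3"
    have \<delta>: "\<delta> > 0" using z by (simp add: \<delta>_def)
    obtain r where r: "\<And>i. i \<ge> r \<Longrightarrow> norm (c0_nth z i) < \<delta>"
      using LIMSEQ_D[OF c0_tendsto[of z] \<delta>] by auto
    \<comment> \<open>The orbit shows a block divided by \<open>growth\<close>, so the block has to approximate \<open>growth i * z i\<close>.\<close>
    have "\<exists>d\<in>D. d \<in> ball (of_real (growth i) * c0_nth z i) (\<delta> * growth i)" for i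
      using \<delta> by (intro D(2)) (simp_all add: not_le)
    then obtain d where d: "\<And>i. d i \<in> D"
        "\<And>i. d i \<in> ball (of_real (growth i) * c0_nth z i) (\<delta> * growth i)"
      by metis
    define xs where "xs = map d [0..<r]"
    obtain N1 where N1: "1 / real (Suc N1) < \<delta>"
      using reals_Archimedean[OF \<delta>] by (auto simp: inverse_eq_divide)
    obtain N2 where N2: "\<And>i. i < r \<Longrightarrow> norm (d i) \<le> real N2"
    proof -
      have "norm (d i) \<le> real (nat \<lceil>\<Sum>i<r. norm (d i)\<rceil>)" if "i < r" for i
        using member_le_sum[of i "{..<r}" "\<lambda>i. norm (d i)"] that
          real_nat_ceiling_ge[of "\<Sum>i<r. norm (d i)"] by auto
      then show thesis using that by blast
    qed
    have "xs \<in> lists D"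
      using d(1) by (auto simp: xs_def)
    then obtain p where p: "p \<ge> max r (max N1 N2)" "f p = xs"
      using f by blast
    have "1 / real (Suc p) \<le> 1 / real (Suc N1)"
      using p by (intro divide_left_mono) auto
    then have p1: "1 / real (Suc p) < \<delta>"
      using N1 by linarith
    have "(dip_shift ^^ n) x \<in> U" if n: "n \<in> visits p" for n
    proof -
      have "norm (c0_nth ((dip_shift ^^ n) x) i - c0_nth z i) \<le> 2 * \<delta>" for i
      proof (cases "i < r")
        case True
        have "norm (d i) \<le> real p"
          using N2[OF True] p by simp
        then have "c0_nth ((dip_shift ^^ n) x) i = d i / of_real (growth i)"
          using True p x(1)[OF n, of i] by (simp add: b_def xs_def)
        then have "c0_nth ((dip_shift ^^ n) x) i - c0_nth z i
            = (d i - of_real (growth i) * c0_nth z i) / of_real (growth i)"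
          by (simp add: diff_divide_distrib)
        then have "norm (c0_nth ((dip_shift ^^ n) x) i - c0_nth z i) =
            norm (d i - of_real (growth i) * c0_nth z i) / growth i"
          by (simp add: norm_divide less_imp_le)
        also have "\<dots> \<le> \<delta>"
          using d(2)[of i] by (simp add: pos_divide_le_eq dist_norm norm_minus_commute less_imp_le)
        finally show ?thesis using \<delta> by linarith
      next
        case False
        have "norm (c0_nth ((dip_shift ^^ n) x) i) \<le> \<delta>"
        proof (cases "i < p")
          case True
          then show ?thesis
            using x(1)[OF n True] False p \<delta> by (simp add: b_def xs_def)
        next
          case False
          then show ?thesis
            using x(2)[OF n, of i] p1 by linarith
        qed
        then show ?thesis
          using r[of i] False norm_triangle_ineq4[of "c0_nth ((dip_shift ^^ n) x) i" "c0_nth z i"]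
          by linarith
      qed
      then have "norm ((dip_shift ^^ n) x - z) \<le> 2 * \<delta>"
        by (intro norm_c0_le) (simp add: minus_c0.rep_eq)
      also have "\<dots> < e"
        using z by (simp add: \<delta>_def)
      finally show ?thesis
        by (intro z(2)) (simp add: dist_norm)
    qed
    then show ?thesis
      by (intro Hin_superset[OF visits_Hin[of p]]) auto
  qed
  then show ?thesis
    unfolding very_frequently_hypercyclic_def by blast
qed

lemma dip_shift_counterexample:
  "\<exists>w :: nat \<Rightarrow> 'k::{real_normed_field, euclidean_space}.
    (\<forall>n\<ge>1. w n \<noteq> 0) \<and> bounded (w ` {1..}) \<and>
    very_frequently_hypercyclic (weighted_shift w) \<and>
    \<not> chaotic (weighted_shift w) \<and>
    (\<nexists>c. norm c = 1 \<and> eigenvalue (weighted_shift w) c) \<and>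
    \<not> mixing (weighted_shift w) \<and>
    (\<nexists>M. gaussian_measure M \<and> M \<noteq> return borel 0 \<and>
         invariant_measure (weighted_shift w) M)"
proof (intro exI[of _ dip_weight] conjI allI impI)
  show "\<nexists>c :: 'k. norm c = 1 \<and> eigenvalue dip_shift c"
    using dip_shift_no_unimodular_eigenvalue by blast
  show "\<nexists>M :: 'k c0 measure. gaussian_measure M \<and> M \<noteq> return borel 0 \<and> invariant_measure dip_shift M"
    unfolding gaussian_measure_def using dip_shift_invariant_measure by blast
qed (rule dip_weight_nonzero dip_weight_bounded dip_shift_very_frequently_hypercyclic
  dip_shift_not_chaotic dip_shift_not_mixing)+

theorem theorem38:
  shows "(\<exists>w :: nat \<Rightarrow> real.
            (\<forall>n\<ge>1. w n \<noteq> 0) \<and> bounded (w ` {1..}) \<and>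
            very_frequently_hypercyclic (weighted_shift w) \<and>
            \<not> chaotic (weighted_shift w) \<and>
            (\<nexists>c. norm c = 1 \<and> eigenvalue (weighted_shift w) c) \<and>
            \<not> mixing (weighted_shift w) \<and>
            (\<nexists>M. gaussian_measure M \<and> M \<noteq> return borel 0 \<and>
                 invariant_measure (weighted_shift w) M)) \<and>
         (\<exists>w :: nat \<Rightarrow> complex.
            (\<forall>n\<ge>1. w n \<noteq> 0) \<and> bounded (w ` {1..}) \<and>
            very_frequently_hypercyclic (weighted_shift w) \<and>
            \<not> chaotic (weighted_shift w) \<and>
            (\<nexists>c. norm c = 1 \<and> eigenvalue (weighted_shift w) c) \<and>
            \<not> mixing (weighted_shift w) \<and>
            (\<nexists>M. gaussian_measure M \<and> M \<noteq> return borel 0 \<and>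
                 invariant_measure (weighted_shift w) M))"
  by (intro conjI dip_shift_counterexample)

end
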